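(* Let $\mathcal{H}_1,\mathcal{H}_2$ be real Hilbert spaces, let $A:\mathcal{H}_1\to 2^{\mathcal{H}_1}$ and $B:\mathcal{H}_2\to 2^{\mathcal{H}_2}$ be monotone operators, let $C:\mathcal{H}_1\to\mathcal{H}_2$ be a linear operator with adjoint $C^\top:\mathcal{H}_2\to\mathcal{H}_1$, and let $$\mathcal{S}=\begin{bmatrix} A & -C^\top\\ C & B\end{bmatrix}:\mathcal{H}_1\times\mathcal{H}_2\to 2^{\mathcal{H}_1}\times 2^{\mathcal{H}_2},\qquad \mathcal{S}(a,b)=(Aa-C^\top b)\times(Ca+Bb).$$ If $A$ and $B$ are maximally monotone, then $\mathcal{S}$ is maximally monotone.
   Context: An operator $M:\mathcal{H}\to2^{\mathcal{H}}$ on a real Hilbert space is monotone if $\langle x-y\,|\,u-v\rangle\ge0$ for all $u\in Mx$, $v\in My$, and maximally monotone if it is monotone and no monotone operator has a graph properly containing that of $M$. The product $\mathcal{H}_1\times\mathcal{H}_2$ carries the inner product $\langle (a,b)\,|\,(c,d)\rangle=\langle a|c\rangle+\langle b|d\rangle$. *)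

theory Defs
  imports "HOL-Analysis.Analysis"
begin

definition op_graph :: "('a \<Rightarrow> 'b set) \<Rightarrow> ('a \<times> 'b) set" where
  "op_graph M = {(x, u). u \<in> M x}"

definition monotone_operator :: "('a::real_inner \<Rightarrow> 'a set) \<Rightarrow> bool" where
  "monotone_operator M \<longleftrightarrow>
     (\<forall>x y. \<forall>u\<in>M x. \<forall>v\<in>M y. inner (x - y) (u - v) \<ge> 0)"

definition maximally_monotone :: "('a::real_inner \<Rightarrow> 'a set) \<Rightarrow> bool" where
  "maximally_monotone M \<longleftrightarrow>
     monotone_operator M \<and>
     (\<nexists>N. monotone_operator N \<and> op_graph M \<subset> op_graph N)"

(* The library's adjoint is a Hilbert choice, meaningful only when an adjoint
   exists; the library guarantees existence only for Euclidean spaces. No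
   boundedness of C is presupposed here. *)
definition has_adjoint :: "('a::real_inner \<Rightarrow> 'b::real_inner) \<Rightarrow> bool" where
  "has_adjoint C \<longleftrightarrow> (\<exists>D. \<forall>x y. inner (C x) y = inner x (D y))"

lemma has_adjoint_works:
  assumes "has_adjoint C"
  shows "inner (C x) y = inner x (adjoint C y)"
  using assms adjoint_unique unfolding has_adjoint_def by metis

definition block_operator ::
  "('a::real_inner \<Rightarrow> 'a set) \<Rightarrow> ('b::real_inner \<Rightarrow> 'b set) \<Rightarrow> ('a \<Rightarrow> 'b)
    \<Rightarrow> 'a \<times> 'b \<Rightarrow> ('a \<times> 'b) set" where
  "block_operator A B C = (\<lambda>(a, b).
     ((\<lambda>u. u - adjoint C b) ` A a) \<times> ((\<lambda>v. C a + v) ` B b))"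

end

(* The off-diagonal part of the block operator is skew, so it drops out of every inner product
   that tests monotonicity, and no continuity of C is needed: a pair is monotonically related to
   the graph of the block operator iff the pair shifted by the off-diagonal part is monotonically
   related to the graph of the product of A and B. A product of maximally monotone operators is
   maximally monotone: if one component of a related pair had a negative pairing with some point
   of its graph, the other component would pair strictly positively with its whole graph, hence
   belong to it by maximality, and pairing it with itself would give 0 > 0. *)
theory Submission
  imports Defs
begin

text \<open>This replaces the quantifier over operators by one over points. A pair related to the
  whole graph but outside it could be adjoined, giving a proper monotone extension; conversely, each
  pair of a monotone extension is related to the original graph.\<close>

lemma maximally_monotone_iff_related:
  "maximally_monotone M \<longleftrightarrow> monotone_operator M \<and>
     (\<forall>x u. (\<forall>y. \<forall>v\<in>M y. inner (x - y) (u - v) \<ge> 0) \<longrightarrow> u \<in> M x)"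
  (is "_ \<longleftrightarrow> _ \<and> ?related")
proof (intro iffI conjI)
  assume max: "maximally_monotone M"
  then show mono: "monotone_operator M"
    by (simp add: maximally_monotone_def)
  show ?related
  proof (intro allI impI, rule ccontr)
    fix x u
    assume rel: "\<forall>y. \<forall>v\<in>M y. inner (x - y) (u - v) \<ge> 0" and "u \<notin> M x"
    define N where "N = M(x := insert u (M x))"
    have N_iff: "v \<in> N y \<longleftrightarrow> v \<in> M y \<or> (y = x \<and> v = u)" for y v
      by (auto simp: N_def)
    \<comment> \<open>The adjoined pair may stand on either side in the monotonicity condition,
      while \<open>rel\<close> covers only one order.\<close>
    have swap: "inner (y - x) (v - u) = inner (x - y) (u - v)" for y v
      by (simp add: inner_diff_left inner_diff_right)
    have "monotone_operator N"
      using mono rel by (auto simp: monotone_operator_def N_iff swap)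
    moreover have "op_graph M \<subset> op_graph N"
      using \<open>u \<notin> M x\<close> by (auto simp: op_graph_def N_iff)
    ultimately show False
      using max by (auto simp: maximally_monotone_def)
  qed
next
  assume R: "monotone_operator M \<and> ?related"
  have "op_graph N \<subseteq> op_graph M"
    if N: "monotone_operator N" and sub: "op_graph M \<subseteq> op_graph N" for N
  proof clarify
    fix x u
    assume "(x, u) \<in> op_graph N"
    then have "\<forall>y. \<forall>v\<in>M y. inner (x - y) (u - v) \<ge> 0"
      using N sub by (auto simp: monotone_operator_def op_graph_def subset_iff)
    then show "(x, u) \<in> op_graph M"
      using R by (simp add: op_graph_def)
  qed
  then show "maximally_monotone M"
    using R unfolding maximally_monotone_def by blast
qed

text \<open>Moving \<open>adjoint C\<close> to the other side of the inner product turns its cross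
  terms into the negatives of those coming from \<open>C\<close>, so they cancel.\<close>

lemma inner_block_difference:
  assumes "linear C" and "has_adjoint C"
  shows "inner ((a, b) - (c, d)) ((p - adjoint C b, C a + q) - (r - adjoint C d, C c + s))
    = inner (a - c) (p - r) + inner (b - d) (q - s)"
proof -
  have "inner x (adjoint C y) = inner y (C x)" for x y
    using has_adjoint_works[OF assms(2)] by (metis inner_commute)
  then show ?thesis
    by (simp add: inner_diff_left inner_diff_right inner_add_right linear_diff[OF assms(1)])
qed

theorem lemma2p6:
  fixes A :: "'a::{real_inner, complete_space} \<Rightarrow> 'a set"
    and B :: "'b::{real_inner, complete_space} \<Rightarrow> 'b set"
    and C :: "'a \<Rightarrow> 'b"
  assumes "monotone_operator A" and "monotone_operator B"
    and "linear C" and "has_adjoint C"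
    and "maximally_monotone A" and "maximally_monotone B"
  shows "maximally_monotone (block_operator A B C)"
  unfolding maximally_monotone_iff_related
proof (intro conjI allI impI)
  note inner_block = inner_block_difference[OF assms(3,4)]
  show "monotone_operator (block_operator A B C)"
    unfolding monotone_operator_def
  proof (intro allI ballI)
    fix x y u v
    assume "u \<in> block_operator A B C x" "v \<in> block_operator A B C y"
    then obtain a b p q c d r s where
      "x = (a, b)" "u = (p - adjoint C b, C a + q)" "p \<in> A a" "q \<in> B b"
      "y = (c, d)" "v = (r - adjoint C d, C c + s)" "r \<in> A c" "s \<in> B d"
      by (cases x; cases y) (auto simp: block_operator_def)
    then show "inner (x - y) (u - v) \<ge> 0"
      using assms(1,2) by (simp only: inner_block) (simp add: monotone_operator_def)
  qed
  fix x u
  assume rel: "\<forall>y. \<forall>v\<in>block_operator A B C y. inner (x - y) (u - v) \<ge> 0"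
  obtain a b where x: "x = (a, b)"
    by (cases x)
  \<comment> \<open>The off-diagonal shift at \<open>(a, b)\<close> is a translation, so every
    \<open>u\<close> has this form: \<open>p = fst u + adjoint C b\<close> and
    \<open>q = snd u - C a\<close>.\<close>
  obtain p q where u: "u = (p - adjoint C b, C a + q)"
    by (cases u) (metis add_diff_cancel_right' add.commute diff_add_cancel)
  have sum_nonneg: "inner (a - c) (p - r) + inner (b - d) (q - s) \<ge> 0"
    if "r \<in> A c" "s \<in> B d" for c d r s
  proof -
    have "(r - adjoint C d, C c + s) \<in> block_operator A B C (c, d)"
      using that by (simp add: block_operator_def)
    then have "inner ((a, b) - (c, d))
        ((p - adjoint C b, C a + q) - (r - adjoint C d, C c + s)) \<ge> 0"
      using rel unfolding x u by blast
    then show ?thesis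
      by (simp only: inner_block)
  qed
  have maxA: "p \<in> A a" if "\<And>c r. r \<in> A c \<Longrightarrow> inner (a - c) (p - r) \<ge> 0"
    using assms(5) that unfolding maximally_monotone_iff_related by blast
  have maxB: "q \<in> B b" if "\<And>d s. s \<in> B d \<Longrightarrow> inner (b - d) (q - s) \<ge> 0"
    using assms(6) that unfolding maximally_monotone_iff_related by blast
  have "p \<in> A a"
  proof (rule ccontr)
    assume "p \<notin> A a"
    then obtain c r where cr: "r \<in> A c" "inner (a - c) (p - r) < 0"
      using maxA by (meson not_le)
    then have pos: "inner (b - d) (q - s) > 0" if "s \<in> B d" for d s
      using sum_nonneg[OF cr(1) that] by linarith
    then have "q \<in> B b"
      using maxB less_imp_le by blast
    then show False
      using pos by fastforce
  qed
  \<comment> \<open>Now \<open>(a, p)\<close> is itself a point of the graph of \<open>A\<close>;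
    testing against it makes the first summand of \<open>sum_nonneg\<close> vanish.\<close>
  moreover from this have "q \<in> B b"
    using maxB sum_nonneg[OF \<open>p \<in> A a\<close>] by simp
  ultimately show "u \<in> block_operator A B C x"
    by (simp add: x u block_operator_def)
qed

end
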